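(* Let $G$ be a hyperbolic group. Then the group $\mathrm{Inn}(G)$ of inner automorphisms of $G$ is of finite index in $\mathrm{Conj}(G)$.
   Context: A geodesic metric space $X$ is $\delta$-hyperbolic ($\delta\ge 0$) if for every triangle in $X$ with geodesic sides, each side is contained in the $\delta$-neighbourhood of the union of the two other sides. A finitely generated group $G$ is hyperbolic if, for a finite generating set $S$ of $G$ closed under inverses, the Cayley graph $X(G,S)$ with the word metric is $\delta$-hyperbolic for some $\delta\ge 0$. An automorphism $f$ of a group $G$ is called a conjugating automorphism if $f(g)$ is conjugate to $g$ in $G$ for every $g\in G$. The conjugating automorphisms form a normal subgroup $\mathrm{Conj}(G)$ of $\mathrm{Aut}(G)$, which contains $\mathrm{Inn}(G)$. *)

theory Defs
  imports "HOL-Analysis.Analysis" "HOL-Algebra.Algebra"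
begin

section \<open>Hyperbolic spaces\<close>

definition geodesic_path ::
  "'a set \<Rightarrow> ('a \<Rightarrow> 'a \<Rightarrow> real) \<Rightarrow> 'a \<Rightarrow> 'a \<Rightarrow> (real \<Rightarrow> 'a) \<Rightarrow> bool" where
  "geodesic_path M d x y \<gamma> \<longleftrightarrow>
     \<gamma> \<in> {0..d x y} \<rightarrow> M \<and> \<gamma> 0 = x \<and> \<gamma> (d x y) = y \<and>
     (\<forall>s\<in>{0..d x y}. \<forall>t\<in>{0..d x y}. d (\<gamma> s) (\<gamma> t) = \<bar>s - t\<bar>)"

definition geodesic_segment ::
  "'a set \<Rightarrow> ('a \<Rightarrow> 'a \<Rightarrow> real) \<Rightarrow> 'a \<Rightarrow> 'a \<Rightarrow> 'a set \<Rightarrow> bool" where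
  "geodesic_segment M d x y A \<longleftrightarrow> (\<exists>\<gamma>. geodesic_path M d x y \<gamma> \<and> A = \<gamma> ` {0..d x y})"

locale geodesic_metric_space = Metric_space +
  assumes geodesic: "\<And>x y. \<lbrakk>x \<in> M; y \<in> M\<rbrakk> \<Longrightarrow> \<exists>A. geodesic_segment M d x y A"

text \<open>Closed neighbourhoods are used, so that \<open>\<delta> = 0\<close> is meaningful (trees).\<close>

definition neighbourhood :: "'a set \<Rightarrow> ('a \<Rightarrow> 'a \<Rightarrow> real) \<Rightarrow> real \<Rightarrow> 'a set \<Rightarrow> 'a set" where
  "neighbourhood M d \<delta> A = {p \<in> M. \<exists>q\<in>A. d p q \<le> \<delta>}"

definition hyperbolic_space :: "real \<Rightarrow> 'a set \<Rightarrow> ('a \<Rightarrow> 'a \<Rightarrow> real) \<Rightarrow> bool" where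
  "hyperbolic_space \<delta> M d \<longleftrightarrow>
     geodesic_metric_space M d \<and> 0 \<le> \<delta> \<and>
     (\<forall>x\<in>M. \<forall>y\<in>M. \<forall>z\<in>M. \<forall>A B C.
        geodesic_segment M d x y A \<and> geodesic_segment M d y z B \<and> geodesic_segment M d z x C \<longrightarrow>
          A \<subseteq> neighbourhood M d \<delta> (B \<union> C) \<and>
          B \<subseteq> neighbourhood M d \<delta> (C \<union> A) \<and>
          C \<subseteq> neighbourhood M d \<delta> (A \<union> B))"


section \<open>Graphs as length spaces\<close>

text \<open>A graph with vertex set \<open>V\<close> and symmetric irreflexive edge relation \<open>E\<close> is realized
  geometrically by barycentric coordinates: a point is a function on the vertices, and
  \<open>edge_point u v t\<close> is the point at distance \<open>t\<close> from \<open>u\<close> on the edge from \<open>u\<close> to \<open>v\<close>, so that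
  \<open>edge_point u v t = edge_point v u (1 - t)\<close>. Every edge has length 1, and the distance of two
  points is the infimum of the lengths of the piecewise linear paths between them.\<close>

definition vertex_point :: "'a \<Rightarrow> 'a \<Rightarrow> real" where
  "vertex_point u = indicat_real {u}"

definition edge_point :: "'a \<Rightarrow> 'a \<Rightarrow> real \<Rightarrow> 'a \<Rightarrow> real" where
  "edge_point u v t = (\<lambda>w. (1 - t) * vertex_point u w + t * vertex_point v w)"

definition graph_points :: "'a set \<Rightarrow> ('a \<times> 'a) set \<Rightarrow> ('a \<Rightarrow> real) set" where
  "graph_points V E =
     vertex_point ` V \<union> {edge_point u v t |u v t. (u, v) \<in> E \<and> t \<in> {0..1}}"

inductive path_of_length ::
  "'a set \<Rightarrow> ('a \<times> 'a) set \<Rightarrow> ('a \<Rightarrow> real) \<Rightarrow> ('a \<Rightarrow> real) \<Rightarrow> real \<Rightarrow> bool" for V E where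
  const: "p \<in> graph_points V E \<Longrightarrow> path_of_length V E p p 0"
| move: "\<lbrakk>path_of_length V E p (edge_point u v s) L; (u, v) \<in> E; s \<in> {0..1}; t \<in> {0..1}\<rbrakk>
    \<Longrightarrow> path_of_length V E p (edge_point u v t) (L + \<bar>s - t\<bar>)"

text \<open>The locale \<open>Metric_space\<close> requires nonnegativity and symmetry outside the carrier
  as well, hence the value 0 there.\<close>

definition graph_dist ::
  "'a set \<Rightarrow> ('a \<times> 'a) set \<Rightarrow> ('a \<Rightarrow> real) \<Rightarrow> ('a \<Rightarrow> real) \<Rightarrow> real" where
  "graph_dist V E p q =
     (if p \<in> graph_points V E \<and> q \<in> graph_points V E
      then Inf {L. path_of_length V E p q L} else 0)"


section \<open>Cayley graphs and hyperbolic groups\<close>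

text \<open>Loops, which would arise from \<open>\<one> \<in> S\<close>, are left out, and \<open>s\<close> and its inverse give
  the same edge. On \<open>vertex_point ` carrier G\<close> the distance \<open>cayley_dist\<close> is the word metric.\<close>

definition cayley_edges :: "('a, 'b) monoid_scheme \<Rightarrow> 'a set \<Rightarrow> ('a \<times> 'a) set" where
  "cayley_edges G S = {(g, g \<otimes>\<^bsub>G\<^esub> s) |g s. g \<in> carrier G \<and> s \<in> S \<and> s \<noteq> \<one>\<^bsub>G\<^esub>}"

definition cayley_points :: "('a, 'b) monoid_scheme \<Rightarrow> 'a set \<Rightarrow> ('a \<Rightarrow> real) set" where
  "cayley_points G S = graph_points (carrier G) (cayley_edges G S)"

definition cayley_dist ::
  "('a, 'b) monoid_scheme \<Rightarrow> 'a set \<Rightarrow> ('a \<Rightarrow> real) \<Rightarrow> ('a \<Rightarrow> real) \<Rightarrow> real" where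
  "cayley_dist G S = graph_dist (carrier G) (cayley_edges G S)"

definition symmetric_generating_set :: "('a, 'b) monoid_scheme \<Rightarrow> 'a set \<Rightarrow> bool" where
  "symmetric_generating_set G S \<longleftrightarrow>
     S \<subseteq> carrier G \<and> (\<forall>s\<in>S. inv\<^bsub>G\<^esub> s \<in> S) \<and> generate G S = carrier G"

definition hyperbolic_group :: "('a, 'b) monoid_scheme \<Rightarrow> bool" where
  "hyperbolic_group G \<longleftrightarrow>
     group G \<and>
     (\<exists>S. finite S \<and> symmetric_generating_set G S \<and>
        (\<exists>\<delta>\<ge>0. hyperbolic_space \<delta> (cayley_points G S) (cayley_dist G S)))"


section \<open>Inner and conjugating automorphisms\<close>

text \<open>As in \<^theory>\<open>HOL-Algebra.Bij\<close>, automorphisms are extensional functions on the carrier.\<close>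

definition inner_auts :: "('a, 'b) monoid_scheme \<Rightarrow> ('a \<Rightarrow> 'a) set" where
  "inner_auts G = (\<lambda>h. \<lambda>g\<in>carrier G. h \<otimes>\<^bsub>G\<^esub> g \<otimes>\<^bsub>G\<^esub> inv\<^bsub>G\<^esub> h) ` carrier G"

definition conjugating_auts :: "('a, 'b) monoid_scheme \<Rightarrow> ('a \<Rightarrow> 'a) set" where
  "conjugating_auts G =
     {f \<in> auto G. \<forall>g\<in>carrier G. \<exists>h\<in>carrier G. f g = h \<otimes>\<^bsub>G\<^esub> g \<otimes>\<^bsub>G\<^esub> inv\<^bsub>G\<^esub> h}"

definition ConjGroup :: "('a, 'b) monoid_scheme \<Rightarrow> ('a \<Rightarrow> 'a) monoid" where
  "ConjGroup G = AutoGroup G \<lparr>carrier := conjugating_auts G\<rparr>"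

definition finite_index :: "'a set \<Rightarrow> ('a, 'b) monoid_scheme \<Rightarrow> bool" where
  "finite_index H K \<longleftrightarrow> subgroup H K \<and> finite (rcosets\<^bsub>K\<^esub> H)"

end

theory Submission
  imports Defs
begin

text \<open>Let \<open>f\<close> be a conjugating automorphism and let \<open>f s\<close> act on \<open>G\<close> by left translation, for \<open>s\<close> in
  the generating set \<open>S\<close>. Since \<open>f s\<close> and \<open>f s \<otimes> f t = f (s \<otimes> t)\<close> are conjugate to \<open>s\<close> and \<open>s \<otimes> t\<close>,
  each of them moves some point by at most 2. A coarse version of Serre's lemma on groups acting on
  trees then gives a point \<open>x\<close> that all the \<open>f s\<close> move by at most a constant independent of \<open>f\<close>:
  starting at a point \<open>x\<close> of large maximal displacement, either the almost fixed points of all the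
  \<open>f s\<close> with large displacement lie in the same direction, and a step in this direction decreases
  the maximal displacement, or two of them lie in different directions, and then \<open>f s \<otimes> f t\<close>
  translates along an axis and moves every point far. Hence \<open>f\<close> followed by the conjugation with
  \<open>inv x\<close> maps \<open>S\<close> into a fixed finite ball, which leaves finitely many cosets.\<close>

section \<open>Almost fixed points in four-point spaces\<close>

text \<open>Gromov's four-point condition: of the three ways to pair four points, the two largest
  sums of distances differ by at most \<open>e\<close>, which is 0 in a tree.\<close>

locale four_point_space = Metric_space M d for M :: "'a set" and d +
  fixes e :: real
  assumes four_point: "\<lbrakk>x \<in> M; y \<in> M; z \<in> M; w \<in> M\<rbrakk> \<Longrightarrow>
    d x z + d y w \<le> max (d x y + d z w) (d y z + d x w) + e"
begin

lemma e_nonneg: "x \<in> M \<Longrightarrow> 0 \<le> e"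
  using four_point[of x x x x] by simp

text \<open>Twice the Gromov product: in a tree, twice the length of the common initial piece of the
  geodesics from \<open>w\<close> to \<open>x\<close> and \<open>y\<close>. Small values mean
  different directions at \<open>w\<close>.\<close>

abbreviation double_gromov :: "'a \<Rightarrow> 'a \<Rightarrow> 'a \<Rightarrow> real" where
  "double_gromov w x y \<equiv> d w x + d w y - d x y"

text \<open>Sharing a long initial direction is transitive up to the loss \<open>e\<close>; this is
  the four-point condition rearranged.\<close>

lemma double_gromov_min:
  assumes "w \<in> M" "x \<in> M" "y \<in> M" "z \<in> M"
  shows "min (double_gromov w x y) (double_gromov w y z) - e \<le> double_gromov w x z"
  using four_point[of x y z w] assms commute[of x w] commute[of y w] commute[of z w] by linarith

lemma dist_between:
  assumes "x \<in> M" "y \<in> M" "z \<in> M" "w \<in> M" "d x z + d z y = d x y"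
  shows "d z w \<le> max (d x w - d x z) (d y w - d z y) + e"
  using four_point[of x z y w] assms by linarith

text \<open>In a tree, moving from \<open>x\<close> towards an almost fixed point \<open>y\<close>
  shortens the displacement at twice the speed until it is about \<open>L\<close>. Coarsely,
  \<open>dist_between\<close> is used for \<open>z\<close> and for \<open>g z\<close>, each time
  losing \<open>e\<close>.\<close>

lemma dist_isometry_le:
  assumes g: "g \<in> M \<rightarrow> M" "\<And>u v. \<lbrakk>u \<in> M; v \<in> M\<rbrakk> \<Longrightarrow> d (g u) (g v) = d u v"
    and M: "x \<in> M" "y \<in> M" "z \<in> M" and z: "d x z + d z y = d x y"
    and L: "d y (g y) \<le> L"
  shows "d z (g z) \<le> max (d x (g x) - 2 * d x z) L + 2 * e"
proof -
  have gM: "g x \<in> M" "g y \<in> M" "g z \<in> M" using g(1) M by auto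
  have 1: "d z (g z) \<le> max (d x (g z) - d x z) (d y (g z) - d z y) + e"
    using dist_between[OF M gM(3) z] .
  have gz: "d (g x) (g z) + d (g z) (g y) = d (g x) (g y)" using g(2) M z by simp
  have 2: "d (g z) w \<le> max (d (g x) w - d x z) (d (g y) w - d z y) + e" if "w \<in> M" for w
    using dist_between[OF gM that gz] g(2) M by simp
  have a: "d x (g z) \<le> max (d x (g x) - d x z) (d x (g y) - d z y) + e"
    using 2[of x] M by (simp add: commute)
  have b: "d y (g z) \<le> max (d y (g x) - d x z) (d y (g y) - d z y) + e"
    using 2[of y] M by (simp add: commute)
  have c: "d x (g y) \<le> d x y + L" using triangle[of x y "g y"] M gM L by simp
  have d: "d y (g x) \<le> d x y + L"
    using triangle[of y "g y" "g x"] g(2)[of y x] M gM L commute[of x y] by simp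
  have "0 \<le> d z y" by simp
  then show ?thesis using 1 a b c d L z by linarith
qed

text \<open>Two geodesics from \<open>x\<close> run together as far as the Gromov product reaches:
  there \<open>z'\<close> is at most \<open>e\<close> farther from \<open>y\<close> than
  \<open>z\<close> is, and another \<open>e\<close> makes the two points close.\<close>

lemma dist_between_between:
  assumes M: "x \<in> M" "y \<in> M" "z \<in> M" "y' \<in> M" "z' \<in> M"
    and z: "d x z = t" "d x z + d z y = d x y"
    and z': "d x z' = t" "d x z' + d z' y' = d x y'"
    and t: "2 * t \<le> double_gromov x y y'"
  shows "d z z' \<le> 2 * e"
proof -
  have 1: "d z z' \<le> max (d x z' - d x z) (d y z' - d z y) + e"
    using dist_between[OF M(1-3) M(5) z(2)] .
  have 2: "d z' y \<le> max (d x y - d x z') (d y' y - d z' y') + e"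
    using dist_between[OF M(1,4,5) M(2) z'(2)] .
  show ?thesis using 1 2 z z' t e_nonneg[OF M(1)] commute[of y' y] commute[of y z'] by linarith
qed

text \<open>If \<open>h\<close> almost fixes a point, then the orbit of every other point turns back.\<close>

lemma dist_square_le:
  assumes h: "h \<in> M \<rightarrow> M" "\<And>u v. \<lbrakk>u \<in> M; v \<in> M\<rbrakk> \<Longrightarrow> d (h u) (h v) = d u v"
    and M: "x \<in> M" "y \<in> M" and L: "d y (h y) \<le> L"
  shows "d x (h (h x)) \<le> d x (h x) + 3 * L + e"
proof -
  have hM: "h x \<in> M" "h y \<in> M" "h (h x) \<in> M" "h (h y) \<in> M" using h(1) M by auto
  \<comment> \<open>\<open>y\<close> is nearly equidistant from the orbit: replacing
    \<open>x\<close> by \<open>h x\<close> costs \<open>L\<close> and by \<open>h (h x)\<close>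
    costs \<open>2 * L\<close>, so both terms of the maximum give at most
    \<open>d x (h x) + 3 * L\<close>.\<close>
  have "d x (h (h x)) + d (h x) y \<le> max (d x (h x) + d (h (h x)) y) (d (h x) (h (h x)) + d x y) + e"
    using four_point[of x "h x" "h (h x)" y] M hM by simp
  moreover have "d (h x) (h (h x)) = d x (h x)" "d (h x) (h y) = d x y"
    "d (h (h x)) (h (h y)) = d x y" "d (h y) (h (h y)) = d y (h y)" using h(2) M hM by auto
  moreover have "d (h (h x)) y \<le> d (h (h x)) (h (h y)) + d (h (h y)) (h y) + d (h y) y"
    using triangle[of "h (h x)" "h (h y)" y] triangle[of "h (h y)" "h y" y] M hM by linarith
  moreover have "d (h x) (h y) \<le> d (h x) y + d y (h y)"
    using triangle[of "h x" y "h y"] M hM by linarith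
  moreover have "0 \<le> d y (h y)" by simp
  ultimately show ?thesis
    using L commute[of "h (h y)" "h y"] commute[of "h y" y] by linarith
qed

text \<open>At \<open>a x\<close>, the directions of \<open>x\<close> and \<open>a (b x)\<close> are those of \<open>p\<close> and \<open>a q\<close>.\<close>

lemma double_gromov_comp_le:
  assumes a: "a \<in> M \<rightarrow> M" "\<And>u v. \<lbrakk>u \<in> M; v \<in> M\<rbrakk> \<Longrightarrow> d (a u) (a v) = d u v"
    and b: "b \<in> M \<rightarrow> M" "\<And>u v. \<lbrakk>u \<in> M; v \<in> M\<rbrakk> \<Longrightarrow> d (b u) (b v) = d u v"
    and M: "x \<in> M" "p \<in> M" "q \<in> M"
    and L: "d p (a p) \<le> L" "d q (b q) \<le> L"
    and m: "d x (a x) > m" "d x (b x) > m" "m \<ge> 2 * T + 3 * L + 2 * e"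
    and T: "double_gromov x p q < 2 * T"
  shows "double_gromov (a x) x (a (b x)) \<le> 2 * T + 2 * L + 2 * e"
proof -
  let ?w = "a x"
  have aM: "a x \<in> M" "a p \<in> M" "a q \<in> M" "b x \<in> M" "b q \<in> M" "a (b x) \<in> M" using a(1) b(1) M by auto
  have e1: "d (a x) (a p) = d x p" "d (a x) (a q) = d x q" "d (a p) (a q) = d p q"
    "d (a x) (a (b x)) = d x (b x)" "d (a (b x)) (a q) = d (b x) q" "d (b x) (b q) = d x q"
    using a(2) b(2) M aM by auto
  have 1: "double_gromov ?w x p \<ge> d x (a x) - L"
    using triangle[of "a x" p "a p"] M aM e1 L commute[of "a x" x] by linarith
  have 2: "double_gromov ?w (a (b x)) (a q) \<ge> d x (b x) - L"
    using triangle[of "b x" "b q" q] M aM e1 L commute[of "b q" q] by linarith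
  have 3: "double_gromov ?w p (a q) < 2 * T + 2 * L"
    using triangle[of "a x" "a p" p] triangle[of "a p" p "a q"] M aM e1 T L commute[of p "a p"]
    by linarith
  \<comment> \<open>By the bound on \<open>m\<close>, \<open>x\<close> agrees with \<open>p\<close>,
    and \<open>a (b x)\<close> with \<open>a q\<close>, for longer than the small product in 3.
    Hence \<open>p\<close> and \<open>a q\<close> can be exchanged for them there, each at the loss
    of \<open>e\<close>.\<close>
  have "min (double_gromov ?w p x) (double_gromov ?w x (a q)) - e \<le> double_gromov ?w p (a q)"
    "min (double_gromov ?w x (a (b x))) (double_gromov ?w (a (b x)) (a q)) - e \<le> double_gromov ?w x (a q)"
    by (rule double_gromov_min; use M aM in simp)+
  then show ?thesis using 1 2 3 m e_nonneg[OF M(1)] commute[of p x] by linarith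
qed

text \<open>Serre's lemma for two isometries. If \<open>p\<close> and \<open>q\<close> lay in
  different directions, the path \<open>x\<close>, \<open>a x\<close>, \<open>a (b x)\<close>, and
  so on would hardly backtrack at its corners, so its fourth point would be much farther from
  \<open>x\<close> than its second. This contradicts \<open>dist_square_le\<close> for the
  composition, which almost fixes \<open>r\<close>.\<close>

lemma double_gromov_ge:
  assumes a: "a \<in> M \<rightarrow> M" "\<And>u v. \<lbrakk>u \<in> M; v \<in> M\<rbrakk> \<Longrightarrow> d (a u) (a v) = d u v"
    and b: "b \<in> M \<rightarrow> M" "\<And>u v. \<lbrakk>u \<in> M; v \<in> M\<rbrakk> \<Longrightarrow> d (b u) (b v) = d u v"
    and M: "x \<in> M" "p \<in> M" "q \<in> M" "r \<in> M"
    and L: "d p (a p) \<le> L" "d q (b q) \<le> L" "d r (a (b r)) \<le> L"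
    and m: "d x (a x) > m" "d x (b x) > m" "m \<ge> 4 * T + 7 * L + 7 * e"
    and T: "0 \<le> T"
  shows "2 * T \<le> double_gromov x p q"
proof (rule ccontr)
  assume "\<not> ?thesis"
  then have lt: "double_gromov x p q < 2 * T" "double_gromov x q p < 2 * T"
    by (auto simp: commute)
  \<comment> \<open>\<open>Q\<close> bounds the backtracking at a corner; the assumption on
    \<open>m\<close> reads \<open>m \<ge> 2 * Q + 3 * L + 3 * e\<close>.\<close>
  define Q where "Q = 2 * T + 2 * L + 2 * e"
  have e0: "0 \<le> e" using e_nonneg M by blast
  have "0 \<le> d p (a p)" by simp
  then have L0: "0 \<le> L" using L by linarith
  have m': "m \<ge> 2 * T + 3 * L + 2 * e" using m(3) T L0 e0 by linarith
  define y1 y2 y3 y4 where "y1 = a x" "y2 = a (b x)" "y3 = a (b (a x))" "y4 = a (b (a (b x)))"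
  note y = y1_y2_y3_y4_def
  have bM: "b x \<in> M" "b (a x) \<in> M" "a (b x) \<in> M" "a x \<in> M" "b (a (b x)) \<in> M" using a(1) b(1) M by auto
  have yM: "y1 \<in> M" "y2 \<in> M" "y3 \<in> M" "y4 \<in> M" using a(1) bM unfolding y by auto
  have ab: "double_gromov (a x) x (a (b x)) \<le> Q"
    unfolding Q_def using double_gromov_comp_le[OF a b M(1-3) L(1,2) m(1,2) m' lt(1)] .
  have ba: "double_gromov (b x) x (b (a x)) \<le> Q"
    unfolding Q_def using double_gromov_comp_le[OF b a M(1,3,2) L(2,1) m(2,1) m' lt(2)] .
  have 1: "double_gromov y1 x y2 \<le> Q" using ab unfolding y .
  have 2: "double_gromov y2 y1 y3 \<le> Q" using ba a(2) M bM unfolding y by simp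
  have 3: "double_gromov y3 y2 y4 \<le> Q" using ab a(2) b(2) M bM unfolding y by simp
  have dy: "d x y1 = d x (a x)" "d y1 y2 = d x (b x)" "d y2 y3 = d x (a x)" "d y3 y4 = d x (b x)"
    using a(2) b(2) M bM unfolding y by simp_all
  have 4: "min (double_gromov y2 y1 x) (double_gromov y2 x y3) - e \<le> double_gromov y2 y1 y3"
    "min (double_gromov y3 y2 x) (double_gromov y3 x y4) - e \<le> double_gromov y3 y2 y4"
    by (rule double_gromov_min; use M yM in simp)+
  have "d x (a (b (a (b x)))) \<le> d x (a (b x)) + 3 * L + e"
    using dist_square_le[of "\<lambda>u. a (b u)" x r L] a b M L by (auto simp: Pi_iff)
  then have 5: "d x y4 \<le> d x y2 + 3 * L + e" unfolding y .
  have c: "d y1 x = d x y1" "d y2 x = d x y2" "d y3 x = d x y3" "d y2 y1 = d y1 y2"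
    "d y3 y2 = d y2 y3" by (simp_all add: commute)
  have mQ: "m \<ge> 2 * Q + 3 * L + 3 * e" using m(3) unfolding Q_def by (simp add: algebra_simps)
  have Q0: "0 \<le> Q" using T L0 e0 unfolding Q_def by simp
  have y2: "d x y2 \<ge> d x (a x) + d x (b x) - Q" using 1 dy c by linarith
  \<comment> \<open>Seen from \<open>y2\<close>, the directions of \<open>y1\<close> and
    \<open>x\<close> agree for more than \<open>Q + e\<close>, so the backtracking relative to
    \<open>x\<close> exceeds that relative to \<open>y1\<close> by at most \<open>e\<close>. The
    same holds at \<open>y3\<close>.\<close>
  have "double_gromov y2 x y3 \<le> Q + e"
    using 4(1) 2 y2 c dy m(1,2) mQ L0 e0 Q0 by linarith
  then have y3: "d x y3 \<ge> d x y2 + d x (a x) - Q - e" using c dy by linarith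
  have "double_gromov y3 x y4 \<le> Q + e"
    using 4(2) 3 y3 c dy m(1,2) mQ L0 e0 Q0 by linarith
  then have "d x y4 \<ge> d x y3 + d x (b x) - Q - e" using c dy by linarith
  then show False using 5 y3 m(1,2) mQ L0 e0 Q0 by linarith
qed

text \<open>One step of the descent: walk \<open>T\<close> in the common direction of the almost
  fixed points. Intermediate points exist at integral distances only, as in a word metric, hence
  \<open>T\<close> is a natural number. \<open>C\<close> is chosen so that
  \<open>K - 2 * T - 1\<close> can serve as \<open>m\<close> in
  \<open>double_gromov_ge\<close>.\<close>

lemma displacement_decrease:
  fixes g :: "'i \<Rightarrow> 'a \<Rightarrow> 'a"
  assumes between: "\<And>u v k. \<lbrakk>u \<in> M; v \<in> M; real k \<le> d u v\<rbrakk> \<Longrightarrow> \<exists>z\<in>M. d u z = k \<and> d u z + d z v = d u v"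
    and g: "\<And>i. i \<in> I \<Longrightarrow> g i \<in> M \<rightarrow> M"
      "\<And>i u v. \<lbrakk>i \<in> I; u \<in> M; v \<in> M\<rbrakk> \<Longrightarrow> d (g i u) (g i v) = d u v"
    and p: "\<And>i. i \<in> I \<Longrightarrow> \<exists>p\<in>M. d p (g i p) \<le> L"
      "\<And>i j. \<lbrakk>i \<in> I; j \<in> I\<rbrakk> \<Longrightarrow> \<exists>p\<in>M. d p (g i (g j p)) \<le> L"
    and T: "6 * e + 1 \<le> 2 * real T"
    and C: "C = 6 * real T + 7 * L + 7 * e + 1" and L: "0 \<le> L" 
    and x: "x \<in> M" "\<And>i. i \<in> I \<Longrightarrow> d x (g i x) \<le> K" and K: "C \<le> K"
  shows "\<exists>z\<in>M. \<forall>i\<in>I. d z (g i z) \<le> K - 1"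
\<comment> \<open>A displacement of at most \<open>K - 2 * T - 1\<close> stays at most
  \<open>K - 1\<close> after a walk of length \<open>T\<close> in any direction; only larger ones
  restrict the direction.\<close>
proof (cases "\<exists>i\<in>I. d x (g i x) > K - 2 * T - 1")
  case False
  then show ?thesis using x T e_nonneg[OF x(1)] by (intro bexI[of _ x]) force+
next
  case True
  then obtain k where k: "k \<in> I" "d x (g k x) > K - 2 * T - 1" by blast
  have e0: "0 \<le> e" using e_nonneg x by blast
  obtain P where P: "\<And>i. i \<in> I \<Longrightarrow> P i \<in> M" "\<And>i. i \<in> I \<Longrightarrow> d (P i) (g i (P i)) \<le> L"
    using p(1) by metis
  have "\<exists>z\<in>M. d x z = T \<and> d x z + d z (P i) = d x (P i)"
    if i: "i \<in> I" "d x (g i x) > K - 2 * T - 1" for i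
  proof -
    have gi: "g i x \<in> M" "g i (P i) \<in> M" using g(1)[OF i(1)] x P(1)[OF i(1)] by auto
    have "d x (g i x) \<le> d x (P i) + d (P i) (g i (P i)) + d (g i (P i)) (g i x)"
      using triangle[of x "P i" "g i x"] triangle[of "P i" "g i (P i)" "g i x"] x gi P(1)[OF i(1)]
      by linarith
    then have "T \<le> d x (P i)"
      using g(2)[OF i(1) P(1)[OF i(1)] x(1)] P(2)[OF i(1)] i(2) K C L e0 commute[of x "P i"] by linarith
    then show ?thesis using between x P(1) i by blast
  qed
  then obtain Z where Z: "\<And>i. \<lbrakk>i \<in> I; d x (g i x) > K - 2 * T - 1\<rbrakk> \<Longrightarrow>
      Z i \<in> M \<and> d x (Z i) = T \<and> d x (Z i) + d (Z i) (P i) = d x (P i)" by metis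
  define z where "z = Z k"
  have z: "z \<in> M" "d x z = T" "d x z + d z (P k) = d x (P k)" using Z[OF k] unfolding z_def by blast+
  have "d z (g i z) \<le> K - 1" if i: "i \<in> I" for i
  proof (cases "d x (g i x) > K - 2 * T - 1")
    case False
    have gM: "g i x \<in> M" "g i z \<in> M" using g(1)[OF i] x z by auto
    have "d z (g i z) \<le> d z x + d x (g i x) + d (g i x) (g i z)"
      using triangle[of z x "g i z"] triangle[of x "g i x" "g i z"] x z gM by linarith
    then show ?thesis using False z g(2)[OF i x(1) z(1)] commute[of x z] by linarith
  next
    case True
    note Zi = Z[OF i True]
    have gM: "g i (Z i) \<in> M" "g i z \<in> M" using g(1)[OF i] Zi z by auto
    obtain r where r: "r \<in> M" "d r (g i (g k r)) \<le> L" using p(2)[OF i k(1)] by blast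
    have "2 * real T \<le> double_gromov x (P i) (P k)"
      by (rule double_gromov_ge[of "g i" "g k" _ _ _ r L "K - 2 * T - 1"])
        (use g i k P r x True K C in auto)
    then have close: "d (Z i) z \<le> 2 * e"
      using dist_between_between[of x "P i" "Z i" "P k" z T] Zi z P i k x by simp
    have "d (Z i) (g i (Z i)) \<le> max (d x (g i x) - 2 * d x (Z i)) L + 2 * e"
      by (rule dist_isometry_le[of _ _ "P i"]) (use g i P x Zi in auto)
    \<comment> \<open>\<open>6 * e + 1 \<le> 2 * T\<close> leaves room for \<open>4 * e\<close>, the
      cost of passing from \<open>z\<close> to \<open>Z i\<close> and from \<open>g i (Z i)\<close>
      to \<open>g i z\<close>.\<close>
    then have "d (Z i) (g i (Z i)) \<le> K - 1 - 4 * e" using Zi x(2)[OF i] T K C L e0 by linarith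
    moreover have "d z (g i z) \<le> d z (Z i) + d (Z i) (g i (Z i)) + d (g i (Z i)) (g i z)"
      using triangle[of z "Z i" "g i z"] triangle[of "Z i" "g i (Z i)" "g i z"] z Zi gM by linarith
    ultimately show ?thesis using close g(2)[OF i _ z(1), of "Z i"] Zi commute[of z "Z i"] by linarith
  qed
  then show ?thesis using z by blast
qed

text \<open>At any starting point the finitely many displacements have a common bound, and
  \<open>displacement_decrease\<close> lowers it in unit steps down to \<open>C\<close>. The final
  bound depends on \<open>L\<close> and \<open>e\<close> only.\<close>

theorem bounded_displacement:
  fixes g :: "'i \<Rightarrow> 'a \<Rightarrow> 'a"
  assumes between: "\<And>u v k. \<lbrakk>u \<in> M; v \<in> M; real k \<le> d u v\<rbrakk> \<Longrightarrow> \<exists>z\<in>M. d u z = k \<and> d u z + d z v = d u v"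
    and I: "finite I" and "M \<noteq> {}"
    and g: "\<And>i. i \<in> I \<Longrightarrow> g i \<in> M \<rightarrow> M"
      "\<And>i u v. \<lbrakk>i \<in> I; u \<in> M; v \<in> M\<rbrakk> \<Longrightarrow> d (g i u) (g i v) = d u v"
    and p: "\<And>i. i \<in> I \<Longrightarrow> \<exists>p\<in>M. d p (g i p) \<le> L"
      "\<And>i j. \<lbrakk>i \<in> I; j \<in> I\<rbrakk> \<Longrightarrow> \<exists>p\<in>M. d p (g i (g j p)) \<le> L"
    and L: "0 \<le> L"
  shows "\<exists>x\<in>M. \<forall>i\<in>I. d x (g i x) \<le> 7 * L + 25 * e + 13"
proof -
  obtain x0 where x0: "x0 \<in> M" using \<open>M \<noteq> {}\<close> by blast
  \<comment> \<open>The least natural number that is at least \<open>3 * e + 1\<close>;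
    \<open>T < 3 * e + 2\<close> bounds \<open>C\<close> by the constant claimed.\<close>
  define T where "T = nat \<lceil>3 * e + 1\<rceil>"
  have e0: "0 \<le> e" using e_nonneg x0 by blast
  have T: "6 * e + 1 \<le> 2 * real T" "real T < 3 * e + 2" using e0 unfolding T_def by linarith+
  define C where "C = 6 * real T + 7 * L + 7 * e + 1"
  have C0: "0 \<le> C" "C \<le> 7 * L + 25 * e + 13" using T L e0 unfolding C_def by linarith+
  have reduce: "\<exists>x\<in>M. \<forall>i\<in>I. d x (g i x) \<le> C" if "x \<in> M" "\<forall>i\<in>I. d x (g i x) \<le> C + real n" for x n
    using that
  proof (induction n arbitrary: x)
    case (Suc n)
    have "\<exists>z\<in>M. \<forall>i\<in>I. d z (g i z) \<le> (C + real (Suc n)) - 1"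
      by (rule displacement_decrease[of I g L T C x])
        (use between g p T(1) L Suc.prems in \<open>auto simp: C_def\<close>)
    then obtain z where "z \<in> M" "\<forall>i\<in>I. d z (g i z) \<le> C + real n" by auto
    then show ?case by (rule Suc.IH)
  qed auto
  obtain B where B: "\<forall>i\<in>I. d x0 (g i x0) \<le> B"
    using finite_imageI[OF I, of "\<lambda>i. d x0 (g i x0)"] bdd_above_finite[of "(\<lambda>i. d x0 (g i x0)) ` I"]
    by (auto simp: bdd_above_def)
  have "\<forall>i\<in>I. d x0 (g i x0) \<le> C + real (nat \<lceil>B\<rceil>)" using B C0 by (smt (verit) real_nat_ceiling_ge)
  from reduce[OF x0 this] show ?thesis using C0(2) by (meson order_trans)
qed

end

section \<open>Thin triangles and the four-point condition\<close>

lemma geodesic_segment_dist: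
  assumes "geodesic_segment M d x y A" "q \<in> A"
  shows "q \<in> M" "d x q + d q y = d x y"
proof -
  obtain \<gamma> t where \<gamma>: "geodesic_path M d x y \<gamma>" and t: "t \<in> {0..d x y}" "q = \<gamma> t"
    using assms unfolding geodesic_segment_def by blast
  have "0 \<in> {0..d x y}" "d x y \<in> {0..d x y}" using t by auto
  then have "d x q = \<bar>0 - t\<bar>" "d q y = \<bar>t - d x y\<bar>"
    using \<gamma> t unfolding geodesic_path_def by metis+
  then show "d x q + d q y = d x y" using t by simp
  show "q \<in> M" using \<gamma> t unfolding geodesic_path_def by blast
qed

text \<open>The point facing the centre of the tripod is \<delta>-close to another side, and its
  position along that side is known up to \<delta>. This costs \<open>2 * \<delta>\<close>, doubled
  like the Gromov product.\<close>

lemma hyperbolic_space_near_point: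
  assumes hyp: "hyperbolic_space \<delta> M d" and M: "x \<in> M" "y \<in> M" "w \<in> M"
    and A: "geodesic_segment M d x y A"
  shows "\<exists>p\<in>A. 2 * d w p \<le> d w x + d w y - d x y + 4 * \<delta>"
proof -
  interpret geodesic_metric_space M d using hyp by (simp add: hyperbolic_space_def)
  obtain B C where BC: "geodesic_segment M d y w B" "geodesic_segment M d w x C"
    using geodesic M by meson
  obtain \<gamma> where \<gamma>: "geodesic_path M d x y \<gamma>" "A = \<gamma> ` {0..d x y}"
    using A unfolding geodesic_segment_def by blast
  \<comment> \<open>in a tripod, \<open>t\<close> is the distance from \<open>x\<close> to the centre\<close>
  define t where "t = (d x y + d x w - d y w) / 2"
  have t: "t \<in> {0..d x y}"
    using triangle[of y x w] triangle[of x y w] M commute[of y x] unfolding t_def by auto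
  define p where "p = \<gamma> t"
  have pA: "p \<in> A" using t \<gamma> unfolding p_def by blast
  have "0 \<in> {0..d x y}" by simp
  then have "d x p = \<bar>0 - t\<bar>" using \<gamma>(1) t unfolding p_def geodesic_path_def by metis
  then have xp: "d x p = t" using t by simp
  have p: "p \<in> M" "d x p + d p y = d x y" using geodesic_segment_dist[OF A pA] by blast+
  have "A \<subseteq> neighbourhood M d \<delta> (B \<union> C)"
    using hyp M A BC unfolding hyperbolic_space_def by blast
  then obtain q where q: "q \<in> B \<union> C" "d p q \<le> \<delta>" using pA unfolding neighbourhood_def by blast
  have "2 * d w p \<le> d w x + d w y - d x y + 4 * \<delta>"
  proof (cases "q \<in> B")
    case True
    have qM: "q \<in> M" "d y q + d q w = d y w" using geodesic_segment_dist[OF BC(1) True] by blast+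
    show ?thesis
      using triangle[of w q p] triangle[of p q y] p qM q(2) M xp
        commute[of w q] commute[of q p] commute[of y q] commute[of w y] commute[of w x]
      unfolding t_def by argo
  next
    case False
    then have "q \<in> C" using q by blast
    then have qM: "q \<in> M" "d w q + d q x = d w x" using geodesic_segment_dist[OF BC(2)] by blast+
    show ?thesis
      using triangle[of w q p] triangle[of x q p] p qM q(2) M xp
        commute[of x q] commute[of q p] commute[of w y] commute[of w x]
      unfolding t_def by argo
  qed
  then show ?thesis using pA by blast
qed

text \<open>The Gromov product at \<open>w\<close> is at most the distance from \<open>w\<close> to
  any point of the side, and up to \<open>2 * \<delta>\<close> this is sharp at some point. Passing
  from that point to another side costs \<delta>; doubling \<open>3 * \<delta>\<close> gives the
  constant.\<close>

lemma hyperbolic_space_four_point: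
  assumes hyp: "hyperbolic_space \<delta> M d"
  shows "four_point_space M d (6 * \<delta>)"
proof -
  interpret geodesic_metric_space M d using hyp by (simp add: hyperbolic_space_def)
  show ?thesis
  proof unfold_locales
    fix x y z w assume M: "x \<in> M" "y \<in> M" "z \<in> M" "w \<in> M"
    obtain A B C where ABC: "geodesic_segment M d x y A" "geodesic_segment M d y z B"
      "geodesic_segment M d z x C" using geodesic M by meson
    obtain p where p: "p \<in> C" "2 * d w p \<le> d w z + d w x - d z x + 4 * \<delta>"
      using hyperbolic_space_near_point[OF hyp M(3,1,4) ABC(3)] by blast
    have "C \<subseteq> neighbourhood M d \<delta> (A \<union> B)"
      using hyp M ABC unfolding hyperbolic_space_def by blast
    then obtain q where q: "q \<in> A \<union> B" "d p q \<le> \<delta>" "p \<in> M"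
      using p(1) unfolding neighbourhood_def by blast
    have far: "d w a + d w b - d a b \<le> 2 * d w q"
      if "geodesic_segment M d a b D" "q \<in> D" "a \<in> M" "b \<in> M" for a b D
      using geodesic_segment_dist[OF that(1,2)] triangle[of w q a] triangle[of w q b] that M
        commute[of a q] by simp
    have "q \<in> M" using geodesic_segment_dist(1)[OF ABC(1)] geodesic_segment_dist(1)[OF ABC(2)] q(1) by blast
    then have wq: "d w q \<le> d w p + \<delta>" using triangle[of w p q] q M by simp
    have "d w x + d w y - d x y \<le> 2 * d w q \<or> d w y + d w z - d y z \<le> 2 * d w q"
      using q(1) far[OF ABC(1) _ M(1,2)] far[OF ABC(2) _ M(2,3)] by blast
    then show "d x z + d y w \<le> max (d x y + d z w) (d y z + d x w) + 6 * \<delta>"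
      using wq p(2) commute[of w x] commute[of w y] commute[of w z] commute[of z x] by linarith
  qed
qed

section \<open>Distances in Cayley graphs\<close>

text \<open>An unspecified number if no walk joins \<open>u\<close> to \<open>v\<close>, hence the
  reachability assumptions below.\<close>

definition edge_dist :: "('a \<times> 'a) set \<Rightarrow> 'a \<Rightarrow> 'a \<Rightarrow> nat" where
  "edge_dist E u v = (LEAST n. (u, v) \<in> E ^^ n)"

lemma edge_dist_relpow: "(u, v) \<in> E\<^sup>* \<Longrightarrow> (u, v) \<in> E ^^ edge_dist E u v"
  unfolding edge_dist_def by (metis LeastI rtrancl_imp_relpow)

lemma edge_dist_le: "(u, v) \<in> E ^^ n \<Longrightarrow> edge_dist E u v \<le> n"
  unfolding edge_dist_def by (rule Least_le)

lemma edge_dist_edge_le: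
  assumes "(u, v) \<in> E\<^sup>*" "(v, w) \<in> E"
  shows "edge_dist E u w \<le> edge_dist E u v + 1"
  using edge_dist_le[of u w "Suc (edge_dist E u v)"] edge_dist_relpow[OF assms(1)] assms(2) by auto

lemma path_of_length_relpow:
  assumes E: "E \<subseteq> V \<times> V" and u: "u \<in> V" and "(u, v) \<in> E ^^ n"
  shows "path_of_length V E (vertex_point u) (vertex_point v) (real n)"
  using assms(3)
proof (induction n arbitrary: v)
  case 0
  then show ?case using u by (auto simp: graph_points_def intro: path_of_length.const)
next
  case (Suc n)
  then obtain w where w: "(u, w) \<in> E ^^ n" "(w, v) \<in> E" by auto
  have e: "edge_point w v 0 = vertex_point w" "edge_point w v 1 = vertex_point v"
    by (simp_all add: edge_point_def)
  have "path_of_length V E (vertex_point u) (edge_point w v 0) (real n)"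
    unfolding e by (rule Suc.IH[OF w(1)])
  from path_of_length.move[OF this w(2), of 1] show ?case unfolding e by (simp add: add.commute)
qed

text \<open>Applied to the distance from a vertex, this bounds the length of a path from below.\<close>

definition affine_extension :: "('a \<Rightarrow> real) \<Rightarrow> ('a \<Rightarrow> real) \<Rightarrow> real" where
  "affine_extension f p = (\<Sum>w | p w \<noteq> 0. p w * f w)"

lemma affine_extension_edge_point:
  "affine_extension f (edge_point u v t) = (1 - t) * f u + t * f v"
proof -
  have "affine_extension f (edge_point u v t) = (\<Sum>w\<in>{u, v}. edge_point u v t w * f w)"
    unfolding affine_extension_def
    by (rule sum.mono_neutral_left) (auto simp: edge_point_def vertex_point_def indicator_def split: if_splits)
  also have "\<dots> = (1 - t) * f u + t * f v"
    by (cases "u = v") (simp_all add: edge_point_def vertex_point_def distrib_right[symmetric])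
  finally show ?thesis .
qed

lemma affine_extension_vertex_point: "affine_extension f (vertex_point v) = f v"
  using affine_extension_edge_point[of f v v 0] by (simp add: edge_point_def)

lemma affine_extension_path:
  assumes "path_of_length V E p q L"
    and f: "\<And>a b. (a, b) \<in> E \<Longrightarrow> \<bar>f a - f b\<bar> \<le> 1"
  shows "\<bar>affine_extension f q - affine_extension f p\<bar> \<le> L"
  using assms(1)
proof induction
  case (move p u v s L t)
  have "affine_extension f (edge_point u v t) - affine_extension f (edge_point u v s)
      = (s - t) * (f u - f v)"
    unfolding affine_extension_edge_point by (simp add: algebra_simps)
  moreover have "\<bar>(s - t) * (f u - f v)\<bar> \<le> \<bar>s - t\<bar>"
    using f[OF move.hyps(2)] by (simp add: abs_mult mult_left_le)
  ultimately show ?case using move.IH by linarith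
qed simp

text \<open>A shortest edge walk attains the infimum. No path is shorter, since the distance from
  \<open>u\<close> changes by at most 1 along an edge and its affine extension therefore grows by at
  most the length of the path.\<close>

lemma graph_dist_vertex_point:
  assumes E: "E \<subseteq> V \<times> V" "sym E" and conn: "\<And>u v. \<lbrakk>u \<in> V; v \<in> V\<rbrakk> \<Longrightarrow> (u, v) \<in> E\<^sup>*"
    and V: "u \<in> V" "v \<in> V"
  shows "graph_dist V E (vertex_point u) (vertex_point v) = real (edge_dist E u v)"
proof -
  have "Inf {L. path_of_length V E (vertex_point u) (vertex_point v) L} = real (edge_dist E u v)"
  proof (rule cInf_eq_minimum)
    show "real (edge_dist E u v) \<in> {L. path_of_length V E (vertex_point u) (vertex_point v) L}"
      using path_of_length_relpow[OF E(1) V(1) edge_dist_relpow[OF conn[OF V]]] by simp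
  next
    fix L assume "L \<in> {L. path_of_length V E (vertex_point u) (vertex_point v) L}"
    then have path: "path_of_length V E (vertex_point u) (vertex_point v) L" by simp
    have "\<bar>real (edge_dist E u a) - real (edge_dist E u b)\<bar> \<le> 1" if "(a, b) \<in> E" for a b
    proof -
      have "(b, a) \<in> E" "a \<in> V" "b \<in> V" using that E by (auto dest: symD)
      then show ?thesis
        using edge_dist_edge_le[OF conn[OF V(1)] that] edge_dist_edge_le[OF conn[OF V(1)], of b a]
        by linarith
    qed
    from affine_extension_path[OF path, of "\<lambda>a. real (edge_dist E u a)", OF this]
    have "real (edge_dist E u v) - real (edge_dist E u u) \<le> L"
      unfolding affine_extension_vertex_point by linarith
    moreover have "edge_dist E u u = 0" using edge_dist_le[of u u 0 E] by simp
    ultimately show "real (edge_dist E u v) \<le> L" by simp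
  qed
  then show ?thesis using V by (simp add: graph_dist_def graph_points_def)
qed

text \<open>Cut a shortest walk after \<open>k\<close> steps: the pieces bound both distances from
  above, and minimality makes the bounds sharp.\<close>

lemma edge_dist_between:
  assumes "(u, v) \<in> E\<^sup>*" "k \<le> edge_dist E u v"
  shows "\<exists>z. (u, z) \<in> E\<^sup>* \<and> edge_dist E u z = k \<and> edge_dist E u z + edge_dist E z v = edge_dist E u v"
proof -
  let ?n = "edge_dist E u v"
  have "(u, v) \<in> E ^^ (k + (?n - k))" using edge_dist_relpow assms by fastforce
  then obtain z where z: "(u, z) \<in> E ^^ k" "(z, v) \<in> E ^^ (?n - k)"
    unfolding relpow_add by blast
  have c: "(u, z) \<in> E\<^sup>*" "(z, v) \<in> E\<^sup>*" using z relpow_imp_rtrancl by blast+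
  have "(u, v) \<in> E ^^ (edge_dist E u z + edge_dist E z v)"
    unfolding relpow_add using edge_dist_relpow[OF c(1)] edge_dist_relpow[OF c(2)] by (rule relcompI)
  then have "?n \<le> edge_dist E u z + edge_dist E z v" by (rule edge_dist_le)
  then show ?thesis using edge_dist_le[OF z(1)] edge_dist_le[OF z(2)] assms(2) c(1)
    by (intro exI[of _ z]) linarith
qed

section \<open>The word metric: left invariance, connectedness, finite balls\<close>

context group
begin

lemma cayley_edges_subset: "S \<subseteq> carrier G \<Longrightarrow> cayley_edges G S \<subseteq> carrier G \<times> carrier G"
  unfolding cayley_edges_def by auto

lemma sym_cayley_edges:
  assumes "symmetric_generating_set G S"
  shows "sym (cayley_edges G S)"
proof (rule symI)
  fix u v assume "(u, v) \<in> cayley_edges G S"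
  then obtain s where s: "u \<in> carrier G" "v = u \<otimes> s" "s \<in> S" "s \<noteq> \<one>"
    unfolding cayley_edges_def by blast
  then have "inv s \<in> S" "s \<in> carrier G" using assms unfolding symmetric_generating_set_def by auto
  moreover from this s have "u = v \<otimes> inv s" "inv s \<noteq> \<one>" "v \<in> carrier G" 
    by (simp_all add: m_assoc)
  ultimately show "(v, u) \<in> cayley_edges G S" unfolding cayley_edges_def by blast
qed

text \<open>Edges are right multiplications by generators, which commute with left
  translations.\<close>

lemma cayley_edges_translate:
  assumes "S \<subseteq> carrier G" "g \<in> carrier G" "(u, v) \<in> cayley_edges G S ^^ n"
  shows "(g \<otimes> u, g \<otimes> v) \<in> cayley_edges G S ^^ n"
  using assms(3)
proof (induction n arbitrary: v)
  case (Suc n)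
  then obtain w where w: "(u, w) \<in> cayley_edges G S ^^ n" "(w, v) \<in> cayley_edges G S" by auto
  then obtain s where s: "w \<in> carrier G" "v = w \<otimes> s" "s \<in> S" "s \<noteq> \<one>"
    unfolding cayley_edges_def by blast
  then have "g \<otimes> v = (g \<otimes> w) \<otimes> s" "g \<otimes> w \<in> carrier G" using assms by (auto simp: m_assoc)
  then have "(g \<otimes> w, g \<otimes> v) \<in> cayley_edges G S" unfolding cayley_edges_def using s by blast
  then show ?case using Suc.IH[OF w(1)] by auto
qed simp

lemma edge_dist_translate:
  assumes S: "S \<subseteq> carrier G" and G: "g \<in> carrier G" "u \<in> carrier G" "v \<in> carrier G"
  shows "edge_dist (cayley_edges G S) (g \<otimes> u) (g \<otimes> v) = edge_dist (cayley_edges G S) u v"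
proof -
  have "(g \<otimes> u, g \<otimes> v) \<in> cayley_edges G S ^^ n \<longleftrightarrow> (u, v) \<in> cayley_edges G S ^^ n" for n
    using cayley_edges_translate[OF S G(1), of u v n]
      cayley_edges_translate[OF S inv_closed[OF G(1)], of "g \<otimes> u" "g \<otimes> v" n] G
    by (auto simp: m_assoc[symmetric])
  then show ?thesis unfolding edge_dist_def by presburger
qed

lemma cayley_edges_rtrancl_mult:
  assumes S: "symmetric_generating_set G S" and "u \<in> carrier G" "g \<in> carrier G"
  shows "(u, u \<otimes> g) \<in> (cayley_edges G S)\<^sup>*"
proof -
  have gen: "g \<in> generate G S" "S \<subseteq> carrier G" "\<And>s. s \<in> S \<Longrightarrow> inv s \<in> S"
    using S assms(3) unfolding symmetric_generating_set_def by auto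
  \<comment> \<open>For \<open>s = \<one>\<close> there is no edge, and the reflexive closure takes
    over.\<close>
  have step: "(v, v \<otimes> s) \<in> (cayley_edges G S)\<^sup>*" if "v \<in> carrier G" "s \<in> S" for v s
    using that by (cases "s = \<one>") (auto simp: cayley_edges_def)
  show ?thesis using gen(1) assms(2)
  proof (induction arbitrary: u)
    case (eng h1 h2)
    have "h1 \<in> carrier G" "h2 \<in> carrier G" using eng.hyps generate_in_carrier[OF gen(2)] by auto
    then show ?case
      using eng.IH(1)[OF eng.prems] eng.IH(2)[of "u \<otimes> h1"] eng.prems
      by (metis m_assoc m_closed rtrancl_trans)
  qed (use step gen in auto)
qed

lemma cayley_edges_connected:
  assumes "symmetric_generating_set G S" "u \<in> carrier G" "v \<in> carrier G"
  shows "(u, v) \<in> (cayley_edges G S)\<^sup>*"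
  using cayley_edges_rtrancl_mult[OF assms(1,2), of "inv u \<otimes> v"] assms
  by (simp add: m_assoc[symmetric])

lemma finite_cayley_relpow:
  assumes "finite S"
  shows "finite {v. (u, v) \<in> cayley_edges G S ^^ n}"
proof (induction n)
  case (Suc n)
  have "{v. (u, v) \<in> cayley_edges G S ^^ Suc n} \<subseteq>
      (\<lambda>(w, s). w \<otimes> s) ` ({v. (u, v) \<in> cayley_edges G S ^^ n} \<times> S)"
    by (force simp: cayley_edges_def)
  then show ?case by (rule finite_subset) (simp add: Suc assms)
qed simp

lemma finite_cayley_ball:
  assumes S: "finite S" "symmetric_generating_set G S" and u: "u \<in> carrier G"
  shows "finite {v \<in> carrier G. real (edge_dist (cayley_edges G S) u v) \<le> C}"
proof -
  have "{v \<in> carrier G. real (edge_dist (cayley_edges G S) u v) \<le> C} \<subseteq>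
      (\<Union>n\<le>nat \<lfloor>C\<rfloor>. {v. (u, v) \<in> cayley_edges G S ^^ n})"
  proof clarify
    fix v assume v: "v \<in> carrier G" "real (edge_dist (cayley_edges G S) u v) \<le> C"
    then have "edge_dist (cayley_edges G S) u v \<le> nat \<lfloor>C\<rfloor>" by (simp add: le_nat_floor)
    moreover have "(u, v) \<in> cayley_edges G S ^^ edge_dist (cayley_edges G S) u v"
      by (rule edge_dist_relpow[OF cayley_edges_connected[OF S(2) u v(1)]])
    ultimately show "v \<in> (\<Union>n\<le>nat \<lfloor>C\<rfloor>. {v. (u, v) \<in> cayley_edges G S ^^ n})" by blast
  qed
  then show ?thesis by (rule finite_subset) (simp add: finite_cayley_relpow[OF S(1)])
qed

lemma cayley_dist_vertex_point:
  assumes "symmetric_generating_set G S" "u \<in> carrier G" "v \<in> carrier G"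
  shows "cayley_dist G S (vertex_point u) (vertex_point v) = real (edge_dist (cayley_edges G S) u v)"
  unfolding cayley_dist_def
  using assms graph_dist_vertex_point[of "cayley_edges G S" "carrier G"] cayley_edges_subset
    sym_cayley_edges cayley_edges_connected
  by (simp add: symmetric_generating_set_def)

end

lemma vertex_point_eq_iff: "vertex_point u = vertex_point v \<longleftrightarrow> u = v"
  by (auto simp: vertex_point_def indicator_def fun_eq_iff split: if_splits)

text \<open>The four-point condition passes to subsets, here to the vertices. This makes the group
  itself the space, on which left translations act by isometries.\<close>

lemma four_point_space_cayley:
  assumes "hyperbolic_space \<delta> (cayley_points G S) (cayley_dist G S)"
  shows "four_point_space (carrier G) (\<lambda>u v. cayley_dist G S (vertex_point u) (vertex_point v)) (6 * \<delta>)"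
proof -
  interpret X: four_point_space "cayley_points G S" "cayley_dist G S" "6 * \<delta>"
    by (rule hyperbolic_space_four_point[OF assms])
  have "vertex_point u \<in> cayley_points G S" if "u \<in> carrier G" for u
    using that by (simp add: cayley_points_def graph_points_def)
  then show ?thesis
    by unfold_locales (auto simp: X.commute X.triangle X.four_point vertex_point_eq_iff)
qed

section \<open>The groups of conjugating and inner automorphisms\<close>

context group
begin

lemma AutoGroup_simps:
  "carrier (AutoGroup G) = auto G" "\<one>\<^bsub>AutoGroup G\<^esub> = (\<lambda>x\<in>carrier G. x)"
  "\<lbrakk>f \<in> auto G; h \<in> auto G\<rbrakk> \<Longrightarrow> f \<otimes>\<^bsub>AutoGroup G\<^esub> h = compose (carrier G) f h"
  by (auto simp: AutoGroup_def BijGroup_def auto_def)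

lemma auto_closed: "\<lbrakk>f \<in> auto G; x \<in> carrier G\<rbrakk> \<Longrightarrow> f x \<in> carrier G"
  by (auto simp: auto_def hom_def)

lemma subgroup_conjugating_auts: "subgroup (conjugating_auts G) (AutoGroup G)"
proof (rule group.subgroupI[OF AutoGroup])
  show "conjugating_auts G \<subseteq> carrier (AutoGroup G)"
    by (auto simp: conjugating_auts_def AutoGroup_simps)
  have "(\<lambda>x\<in>carrier G. x) \<in> conjugating_auts G"
    by (auto simp: conjugating_auts_def id_in_auto intro!: bexI[of _ \<one>])
  then show "conjugating_auts G \<noteq> {}" by blast
next
  interpret A: group "AutoGroup G" by (rule AutoGroup)
  fix f assume f: "f \<in> conjugating_auts G"
  let ?f' = "inv\<^bsub>AutoGroup G\<^esub> f"
  have fa: "f \<in> auto G" using f by (simp add: conjugating_auts_def)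
  have f'a: "?f' \<in> auto G" using A.inv_closed fa by (simp add: AutoGroup_simps)
  have "compose (carrier G) f ?f' = (\<lambda>x\<in>carrier G. x)"
    using A.r_inv[of f] fa f'a by (simp add: AutoGroup_simps)
  then have ff': "f (?f' g) = g" if "g \<in> carrier G" for g
    using that by (metis compose_eq restrict_apply')
  \<comment> \<open>The conjugator is the one that \<open>f\<close> has at \<open>?f' g\<close>,
    inverted.\<close>
  have "\<exists>h\<in>carrier G. ?f' g = h \<otimes> g \<otimes> inv h" if g: "g \<in> carrier G" for g
  proof -
    have g': "?f' g \<in> carrier G" using auto_closed[OF f'a g] .
    then obtain h where h: "h \<in> carrier G" "g = h \<otimes> ?f' g \<otimes> inv h"
      using f ff'[OF g] unfolding conjugating_auts_def by force
    have "inv h \<otimes> g \<otimes> inv (inv h) = inv h \<otimes> (h \<otimes> ?f' g \<otimes> inv h) \<otimes> h" using h by simp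
    also have "\<dots> = ?f' g" using h(1) g' by (simp add: m_assoc inv_solve_left')
    finally show ?thesis using h(1) by (intro bexI[of _ "inv h"]) auto
  qed
  then show "?f' \<in> conjugating_auts G" using f'a by (simp add: conjugating_auts_def)
next
  interpret A: group "AutoGroup G" by (rule AutoGroup)
  fix f k assume fk: "f \<in> conjugating_auts G" "k \<in> conjugating_auts G"
  then have a: "f \<in> auto G" "k \<in> auto G" by (auto simp: conjugating_auts_def)
  have c: "f \<otimes>\<^bsub>AutoGroup G\<^esub> k \<in> auto G" using A.m_closed a by (simp add: AutoGroup_simps)
  have "\<exists>h\<in>carrier G. f (k g) = h \<otimes> g \<otimes> inv h" if g: "g \<in> carrier G" for g
  proof -
    obtain h1 where h1: "h1 \<in> carrier G" "k g = h1 \<otimes> g \<otimes> inv h1"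
      using fk g by (auto simp: conjugating_auts_def)
    obtain h2 where h2: "h2 \<in> carrier G" "f (k g) = h2 \<otimes> k g \<otimes> inv h2"
      using fk auto_closed[OF a(2) g] by (auto simp: conjugating_auts_def)
    show ?thesis
      using h1 h2 g by (intro bexI[of _ "h2 \<otimes> h1"]) (simp_all add: inv_mult_group m_assoc)
  qed
  then show "f \<otimes>\<^bsub>AutoGroup G\<^esub> k \<in> conjugating_auts G"
    using a c by (simp add: conjugating_auts_def AutoGroup_simps compose_eq)
qed

lemma group_ConjGroup: "group (ConjGroup G)"
  unfolding ConjGroup_def
  using subgroup.subgroup_is_group[OF subgroup_conjugating_auts AutoGroup] .

lemma ConjGroup_simps:
  "carrier (ConjGroup G) = conjugating_auts G" "\<one>\<^bsub>ConjGroup G\<^esub> = (\<lambda>x\<in>carrier G. x)"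
  "\<lbrakk>f \<in> conjugating_auts G; h \<in> conjugating_auts G\<rbrakk>
    \<Longrightarrow> f \<otimes>\<^bsub>ConjGroup G\<^esub> h = compose (carrier G) f h"
  by (auto simp: ConjGroup_def AutoGroup_simps conjugating_auts_def)

lemma inv_cancel_left:
  "\<lbrakk>h \<in> carrier G; g \<in> carrier G\<rbrakk> \<Longrightarrow> h \<otimes> (inv h \<otimes> g) = g"
  "\<lbrakk>h \<in> carrier G; g \<in> carrier G\<rbrakk> \<Longrightarrow> inv h \<otimes> (h \<otimes> g) = g"
  by (simp_all add: m_assoc[symmetric])

lemma conjugation_hom: "h \<in> carrier G \<Longrightarrow> (\<lambda>g\<in>carrier G. h \<otimes> g \<otimes> inv h) \<in> hom G G"
  by (auto simp: hom_def m_assoc inv_cancel_left)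

lemma conjugation_conjugation:
  "\<lbrakk>h \<in> carrier G; k \<in> carrier G\<rbrakk> \<Longrightarrow>
    compose (carrier G) (\<lambda>g\<in>carrier G. h \<otimes> g \<otimes> inv h) (\<lambda>g\<in>carrier G. k \<otimes> g \<otimes> inv k)
      = (\<lambda>g\<in>carrier G. (h \<otimes> k) \<otimes> g \<otimes> inv (h \<otimes> k))"
  by (auto simp: compose_def restrict_def fun_eq_iff inv_mult_group m_assoc)

lemma inner_auts_subset: "inner_auts G \<subseteq> conjugating_auts G"
proof
  fix f assume "f \<in> inner_auts G"
  then obtain h where h: "h \<in> carrier G" and f: "f = (\<lambda>g\<in>carrier G. h \<otimes> g \<otimes> inv h)"
    unfolding inner_auts_def by blast
  have "bij_betw f (carrier G) (carrier G)"
    by (rule bij_betw_byWitness[of _ "\<lambda>g. inv h \<otimes> g \<otimes> h"])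
      (auto simp: f h m_assoc inv_cancel_left)
  then have "f \<in> auto G" using conjugation_hom[OF h] by (simp add: auto_def Bij_def f)
  then show "f \<in> conjugating_auts G" using h unfolding conjugating_auts_def f by auto
qed

lemma subgroup_inner_auts: "subgroup (inner_auts G) (ConjGroup G)"
proof (rule group.subgroupI[OF group_ConjGroup])
  show "inner_auts G \<subseteq> carrier (ConjGroup G)" using inner_auts_subset by (simp add: ConjGroup_simps)
  show "inner_auts G \<noteq> {}" unfolding inner_auts_def by auto
  have mult: "f \<otimes>\<^bsub>ConjGroup G\<^esub> k = compose (carrier G) f k"
    if "f \<in> inner_auts G" "k \<in> inner_auts G" for f k
    using that inner_auts_subset by (intro ConjGroup_simps) auto
  fix f assume "f \<in> inner_auts G"
  then obtain h where h: "h \<in> carrier G" and f: "f = (\<lambda>g\<in>carrier G. h \<otimes> g \<otimes> inv h)"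
    unfolding inner_auts_def by blast
  let ?k = "\<lambda>g\<in>carrier G. inv h \<otimes> g \<otimes> inv (inv h)"
  have k: "?k \<in> inner_auts G" using h unfolding inner_auts_def by blast
  have "?k \<otimes>\<^bsub>ConjGroup G\<^esub> f = \<one>\<^bsub>ConjGroup G\<^esub>"
    using mult[OF k \<open>f \<in> inner_auts G\<close>] conjugation_conjugation[of "inv h" h] h
    by (simp add: f ConjGroup_simps restrict_def fun_eq_iff)
  then have "inv\<^bsub>ConjGroup G\<^esub> f = ?k"
    using group.inv_equality[OF group_ConjGroup] k \<open>f \<in> inner_auts G\<close> inner_auts_subset
    by (metis ConjGroup_simps(1) subsetD)
  then show "inv\<^bsub>ConjGroup G\<^esub> f \<in> inner_auts G" using k by simp
next
  fix f k assume fk: "f \<in> inner_auts G" "k \<in> inner_auts G"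
  then have fk_mult: "f \<otimes>\<^bsub>ConjGroup G\<^esub> k = compose (carrier G) f k"
    using inner_auts_subset by (intro ConjGroup_simps) auto
  obtain a b where ab: "a \<in> carrier G" "b \<in> carrier G"
    and "f = (\<lambda>g\<in>carrier G. a \<otimes> g \<otimes> inv a)" "k = (\<lambda>g\<in>carrier G. b \<otimes> g \<otimes> inv b)"
    using fk unfolding inner_auts_def by blast
  then have "f \<otimes>\<^bsub>ConjGroup G\<^esub> k = (\<lambda>g\<in>carrier G. (a \<otimes> b) \<otimes> g \<otimes> inv (a \<otimes> b))"
    using fk_mult conjugation_conjugation by simp
  then show "f \<otimes>\<^bsub>ConjGroup G\<^esub> k \<in> inner_auts G"
    using ab unfolding inner_auts_def by blast
qed

section \<open>Automorphisms with bounded values on the generators\<close>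

lemma auto_eq_on_generators:
  assumes "f \<in> auto G" "k \<in> auto G" "S \<subseteq> carrier G" "generate G S = carrier G"
    and eq: "\<And>s. s \<in> S \<Longrightarrow> f s = k s"
  shows "f = k"
proof -
  interpret f: group_hom G G f using assms(1) by unfold_locales (simp add: auto_def)
  interpret k: group_hom G G k using assms(2) by unfold_locales (simp add: auto_def)
  have "f x = k x" if "x \<in> generate G S" for x
    using that
  proof induction
    case (eng h1 h2)
    then show ?case using generate_in_carrier[OF assms(3)] by (metis f.hom_mult k.hom_mult)
  qed (use assms in auto)
  moreover have "f \<in> extensional (carrier G)" "k \<in> extensional (carrier G)"
    using assms by (auto simp: auto_def Bij_def)
  ultimately show ?thesis using assms(4) by (auto intro: extensionalityI)
qed

text \<open>An automorphism is determined by its restriction to \<open>S\<close>, and there are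
  finitely many maps from \<open>S\<close> to \<open>B\<close>.\<close>

lemma finite_bounded_auts:
  assumes "finite S" "S \<subseteq> carrier G" "generate G S = carrier G" "finite B"
  shows "finite {f \<in> conjugating_auts G. \<forall>s\<in>S. f s \<in> B}" (is "finite ?F")
proof (rule finite_imageD)
  have "(\<lambda>f. restrict f S) ` ?F \<subseteq> S \<rightarrow>\<^sub>E B" by auto
  then show "finite ((\<lambda>f. restrict f S) ` ?F)" by (rule finite_subset) (simp add: finite_PiE assms)
  show "inj_on (\<lambda>f. restrict f S) ?F"
  proof (rule inj_onI)
    fix f k assume fk: "f \<in> ?F" "k \<in> ?F" "restrict f S = restrict k S"
    then have "f \<in> auto G" "k \<in> auto G" "\<And>s. s \<in> S \<Longrightarrow> f s = k s"
      by (auto simp: conjugating_auts_def) (metis restrict_apply')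
    then show "f = k" by (rule auto_eq_on_generators[OF _ _ assms(2,3)])
  qed
qed

text \<open>\<open>bounded_displacement\<close> for the left translations by \<open>f s\<close>,
  with \<open>L = 2\<close> and \<open>e = 6 * \<delta>\<close>, gives a point \<open>x\<close> that
  they move little; translating by \<open>inv x\<close> turns this into a bound on word length. The
  bound is the same for all \<open>f\<close>.\<close>

lemma conjugating_aut_bounded:
  assumes S: "finite S" "symmetric_generating_set G S"
    and hyp: "hyperbolic_space \<delta> (cayley_points G S) (cayley_dist G S)"
    and f: "f \<in> conjugating_auts G"
  shows "\<exists>x\<in>carrier G. \<forall>s\<in>S.
    real (edge_dist (cayley_edges G S) \<one> (inv x \<otimes> f s \<otimes> x)) \<le> 150 * \<delta> + 27"
proof -
  let ?D = "edge_dist (cayley_edges G S)"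
  define d where "d u v = cayley_dist G S (vertex_point u) (vertex_point v)" for u v
  interpret four_point_space "carrier G" d "6 * \<delta>"
    unfolding d_def by (rule four_point_space_cayley[OF hyp])
  have SG: "S \<subseteq> carrier G" using S unfolding symmetric_generating_set_def by blast
  have d: "d u v = real (?D u v)" if "u \<in> carrier G" "v \<in> carrier G" for u v
    unfolding d_def using cayley_dist_vertex_point[OF S(2) that] .
  have dt: "d (g \<otimes> u) (g \<otimes> v) = d u v"
    if "g \<in> carrier G" "u \<in> carrier G" "v \<in> carrier G" for g u v
    using that d edge_dist_translate[OF SG that] by simp
  have fa: "f \<in> auto G" using f by (simp add: conjugating_auts_def)
  have fG: "f s \<in> carrier G" if "s \<in> carrier G" for s using auto_closed[OF fa that] .
  have s1: "d \<one> s \<le> 1" if "s \<in> S" for s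
  proof (cases "s = \<one>")
    case False
    then have "(\<one>, s) \<in> cayley_edges G S ^^ 1"
      using that SG by (force simp: cayley_edges_def)
    from edge_dist_le[OF this] show ?thesis using d[of \<one> s] that SG by auto
  qed simp
  have s2: "d \<one> (s \<otimes> t) \<le> 2" if "s \<in> S" "t \<in> S" for s t
  proof -
    have G: "s \<in> carrier G" "t \<in> carrier G" using that SG by auto
    then show ?thesis
      using triangle[of \<one> s "s \<otimes> t"] dt[of s \<one> t] s1[OF that(1)] s1[OF that(2)] by simp
  qed
  \<comment> \<open>A conjugate of \<open>g\<close> by \<open>h\<close> moves \<open>h\<close> to
    \<open>h \<otimes> g\<close>, as far as \<open>g\<close> moves \<open>\<one>\<close>.\<close>
  have fixed: "\<exists>p\<in>carrier G. d p (f g \<otimes> p) \<le> 2" if g: "g \<in> carrier G" "d \<one> g \<le> 2" for g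
  proof -
    obtain h where h: "h \<in> carrier G" "f g = h \<otimes> g \<otimes> inv h"
      using f g by (auto simp: conjugating_auts_def)
    then have "f g \<otimes> h = h \<otimes> g" using g by (simp add: m_assoc)
    then show ?thesis using h dt[of h \<one> g] g by (intro bexI[of _ h]) auto
  qed
  have "\<exists>x\<in>carrier G. \<forall>s\<in>S. d x (f s \<otimes> x) \<le> 7 * 2 + 25 * (6 * \<delta>) + 13"
  proof (rule bounded_displacement)
    show "\<exists>z\<in>carrier G. d u z = k \<and> d u z + d z v = d u v"
      if uv: "u \<in> carrier G" "v \<in> carrier G" "real k \<le> d u v" for u v k
    proof -
      obtain z where z: "(u, z) \<in> (cayley_edges G S)\<^sup>*" "?D u z = k" "?D u z + ?D z v = ?D u v"
        using edge_dist_between[OF cayley_edges_connected[OF S(2) uv(1,2)], of k] uv(3) d[OF uv(1,2)]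
        by auto
      have "z \<in> carrier G"
        using z(1) uv(1) cayley_edges_subset[OF SG] by (induction) auto
      then show ?thesis using z d uv by (intro bexI[of _ z]) (auto simp flip: of_nat_add)
    qed
    show "\<exists>p\<in>carrier G. d p (f s \<otimes> p) \<le> 2" if "s \<in> S" for s
      using fixed[of s] s1[OF that] that SG by auto
    show "\<exists>p\<in>carrier G. d p (f s \<otimes> (f t \<otimes> p)) \<le> 2" if st: "s \<in> S" "t \<in> S" for s t
    proof -
      have G: "s \<in> carrier G" "t \<in> carrier G" using st SG by auto
      \<comment> \<open>The conjugacy of \<open>f (s \<otimes> t)\<close> to
        \<open>s \<otimes> t\<close> is what gives the composed translation an almost fixed
        point.\<close>
      have "f (s \<otimes> t) = f s \<otimes> f t" using fa G by (auto simp: auto_def hom_def)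
      then show ?thesis using fixed[of "s \<otimes> t"] s2[OF st] G fG by (auto simp: m_assoc)
    qed
  qed (use S SG fG dt in auto)
  then obtain x where x: "x \<in> carrier G" "\<And>s. s \<in> S \<Longrightarrow> d x (f s \<otimes> x) \<le> 7 * 2 + 25 * (6 * \<delta>) + 13" by blast
  have "real (?D \<one> (inv x \<otimes> f s \<otimes> x)) \<le> 150 * \<delta> + 27" if "s \<in> S" for s
  proof -
    have "f s \<in> carrier G" using that SG fG by auto
    then show ?thesis
      using dt[of "inv x" x "f s \<otimes> x"] d[of \<one> "inv x \<otimes> f s \<otimes> x"] x(1) x(2)[OF that]
      by (simp add: m_assoc)
  qed
  then show ?thesis using x(1) by blast
qed

end

theorem lemma2p2:
  fixes G :: "('a, 'b) monoid_scheme"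
  assumes "hyperbolic_group G"
  shows "finite_index (inner_auts G) (ConjGroup G)"
proof -
  interpret group G using assms by (simp add: hyperbolic_group_def)
  interpret K: group "ConjGroup G" by (rule group_ConjGroup)
  obtain S \<delta> where S: "finite S" "symmetric_generating_set G S"
    and hyp: "hyperbolic_space \<delta> (cayley_points G S) (cayley_dist G S)"
    using assms unfolding hyperbolic_group_def by blast
  have SG: "S \<subseteq> carrier G" "generate G S = carrier G"
    using S(2) unfolding symmetric_generating_set_def by blast+
  define B where
    "B = {g \<in> carrier G. real (edge_dist (cayley_edges G S) \<one>\<^bsub>G\<^esub> g) \<le> 150 * \<delta> + 27}"
  define F where "F = {f \<in> conjugating_auts G. \<forall>s\<in>S. f s \<in> B}"
  have "finite B" unfolding B_def by (rule finite_cayley_ball[OF S one_closed])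
  then have "finite F" unfolding F_def by (rule finite_bounded_auts[OF S(1) SG])
  \<comment> \<open>Each right coset meets \<open>F\<close>: composing \<open>f\<close> with the
    conjugation by \<open>inv x\<close> stays in the coset and brings every value \<open>f s\<close>
    into the ball \<open>B\<close>.\<close>
  have "rcosets\<^bsub>ConjGroup G\<^esub> inner_auts G \<subseteq> (\<lambda>f. inner_auts G #>\<^bsub>ConjGroup G\<^esub> f) ` F"
  proof
    fix c assume "c \<in> rcosets\<^bsub>ConjGroup G\<^esub> inner_auts G"
    then obtain f where f: "f \<in> conjugating_auts G" "c = inner_auts G #>\<^bsub>ConjGroup G\<^esub> f"
      by (auto simp: RCOSETS_def ConjGroup_simps)
    obtain x where x: "x \<in> carrier G" "\<And>s. s \<in> S \<Longrightarrow>
        real (edge_dist (cayley_edges G S) \<one>\<^bsub>G\<^esub> (inv\<^bsub>G\<^esub> x \<otimes>\<^bsub>G\<^esub> f s \<otimes>\<^bsub>G\<^esub> x)) \<le> 150 * \<delta> + 27"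
      using conjugating_aut_bounded[OF S hyp f(1)] by blast
    define i where "i = (\<lambda>g\<in>carrier G. inv\<^bsub>G\<^esub> x \<otimes>\<^bsub>G\<^esub> g \<otimes>\<^bsub>G\<^esub> inv\<^bsub>G\<^esub> (inv\<^bsub>G\<^esub> x))"
    have i: "i \<in> inner_auts G" unfolding i_def inner_auts_def using x(1) by blast
    let ?f = "i \<otimes>\<^bsub>ConjGroup G\<^esub> f"
    have iK: "i \<in> conjugating_auts G" using i inner_auts_subset by blast
    have "?f \<in> inner_auts G #>\<^bsub>ConjGroup G\<^esub> f" using i unfolding r_coset_def by blast
    then have "c = inner_auts G #>\<^bsub>ConjGroup G\<^esub> ?f"
      using K.repr_independence[OF _ _ subgroup_inner_auts] f by (simp add: ConjGroup_simps)
    moreover have "?f \<in> conjugating_auts G"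
      using K.m_closed[of i f] iK f(1) by (simp add: ConjGroup_simps)
    moreover have "?f s \<in> B" if "s \<in> S" for s
    proof -
      have "s \<in> carrier G" "f s \<in> carrier G"
        using that SG f(1) auto_closed by (auto simp: conjugating_auts_def)
      then show ?thesis using x that iK f(1)
        by (simp add: ConjGroup_simps compose_eq i_def B_def)
    qed
    ultimately show "c \<in> (\<lambda>f. inner_auts G #>\<^bsub>ConjGroup G\<^esub> f) ` F" unfolding F_def by blast
  qed
  then have "finite (rcosets\<^bsub>ConjGroup G\<^esub> inner_auts G)"
    by (rule finite_subset) (simp add: \<open>finite F\<close>)
  then show ?thesis using subgroup_inner_auts unfolding finite_index_def by blast
qed

end
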